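(* Let $T$ be an axiomatically appropriate and schematic theory such that for some constant $c$ (and variables $x,y$) and all formulas $A,B$, \[ x:A\to c\cdot x\cdot y:(A\vee B)\in T \quad\text{and}\quad y:B\to c\cdot x\cdot y:(A\vee B)\in T. \] Then there exists a normal realization $r$ such that for all modal formulas $F$, if $\vdash_{\mathsf{K}} F$ then $T\vdash_{\mathsf{SE}} r(F)$.
   Context: Syntax of $\mathsf{SE}$. There are countably infinite sets of justification constants $\mathsf{JConst}=\{0,1,c_1,c_2,\dots\}$ and justification variables $\mathsf{JVar}=\{x_1,x_2,\dots\}$. Terms: constants, variables, and $s\cdot t$, $s+t$ for terms $s,t$ ($c\cdot x\cdot y$ means $(c\cdot x)\cdot y$). Formulas: $\bot$, atomic propositions $P\in\mathsf{Prop}$, $A\to B$, and $t:A$; $\neg,\wedge,\vee,\leftrightarrow$ are abbreviations. $A[w/t]$ is simultaneous replacement of the variable $w$ by term $t$. Axioms of $\mathsf{SE}$ (the axiom schemes, for arbitrary formulas $A,B$ and variables $w,x,y,z$): (CL) propositional tautologies; (j) $x:(A\to B)\to(y:A\to x\cdot y:B)$; (j+) $x:A\wedge y:A\to(x+y):A$; (a+) $A[w/(x+y)+z]\to A[w/x+(y+z)]$; (c+) $A[w/x+y]\to A[w/y+x]$; (0+) $A[w/x+0]\leftrightarrow A[w/x]$; (am) $A[w/(x\cdot y)\cdot z]\leftrightarrow A[w/x\cdot(y\cdot z)]$; (a0) $A[w/x\cdot 0]\leftrightarrow A[w/0]$, $A[w/0\cdot x]\leftrightarrow A[w/0]$; (a1)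 $A[w/x\cdot 1]\leftrightarrow A[w/x]$, $A[w/1\cdot x]\leftrightarrow A[w/x]$; (dl) $A[w/x\cdot(y+z)]\leftrightarrow A[w/x\cdot y+x\cdot z]$; (dr) $A[w/(y+z)\cdot x]\leftrightarrow A[w/y\cdot x+z\cdot x]$. Rules: modus ponens and (jv): from $A$ infer $A[x/t]$. $T\vdash_{\mathsf{SE}}F$: $F$ derivable from axioms and members of the set $T$ by these rules. A theory $T$ is axiomatically appropriate if for every axiom $A$ there is a constant $c$ with $c:A\in T$, and for every $B\in T$ there is a constant $c$ with $c:B\in T$. $T$ is schematic if for each constant $c$, the set $\{A\mid c:A\in T \text{ and } A \text{ is an axiom}\}$ consists of all instances of one or several (possibly zero) axiom schemes of $\mathsf{SE}$. $\mathsf{K}$ is the basic normal modal logic; $\vdash_{\mathsf{K}}F$ means $F$ is a theorem of $\mathsf{K}$. For a formula $A$ of $\mathsf{SE}$, $A^\circ$ is the modal formula obtained by replacing every occurrence of $s:$ by $\Box$. A realization is a mapping $r$ from modal formulas to $\mathsf{SE}$-formulas with $(r(F))^\circ=F$ for all modal $F$. Polarity of subformula occurrences in a modal formula $A$: $A$ itself is positive; if $B\to C$ has a polarity, $C$ gets the same and $B$ the opposite polarity; if $\Box B$ has a polarity, $B$ gets the same. The leading $\Box$ of an occurrence $\Box B$ has the polarity of that occurrence. A realization is normal if all negative occurrences of $\Box$ are mapped to distinct justification variables. *)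

theory Defs
  imports Main
begin

section \<open>Syntax of SE\<close>

datatype jconst = C0 | C1 | C nat

datatype tm =
    Const jconst
  | Var nat
  | Dot tm tm  (infixl \<open>\<odot>\<close> 75)
  | Sum tm tm  (infixl \<open>\<oplus>\<close> 70)

abbreviation TZero :: tm  (\<open>\<^bold>0\<close>) where "\<^bold>0 \<equiv> Const C0"
abbreviation TOne :: tm  (\<open>\<^bold>1\<close>) where "\<^bold>1 \<equiv> Const C1"

datatype 'p fm =
    Bot
  | Atom 'p
  | Imp "'p fm" "'p fm"  (infixr \<open>\<rightarrow>\<^sub>j\<close> 55)
  | Just tm "'p fm"

abbreviation Neg :: "'p fm \<Rightarrow> 'p fm"
  where "Neg A \<equiv> A \<rightarrow>\<^sub>j Bot"
abbreviation Or :: "'p fm \<Rightarrow> 'p fm \<Rightarrow> 'p fm"  (infixr \<open>\<or>\<^sub>j\<close> 60)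
  where "A \<or>\<^sub>j B \<equiv> Neg A \<rightarrow>\<^sub>j B"
abbreviation And :: "'p fm \<Rightarrow> 'p fm \<Rightarrow> 'p fm"  (infixr \<open>\<and>\<^sub>j\<close> 65)
  where "A \<and>\<^sub>j B \<equiv> Neg (A \<rightarrow>\<^sub>j Neg B)"
abbreviation Iff :: "'p fm \<Rightarrow> 'p fm \<Rightarrow> 'p fm"  (infix \<open>\<leftrightarrow>\<^sub>j\<close> 50)
  where "A \<leftrightarrow>\<^sub>j B \<equiv> (A \<rightarrow>\<^sub>j B) \<and>\<^sub>j (B \<rightarrow>\<^sub>j A)"

text \<open>\<open>subst A w t\<close> is $A[w/t]$.\<close>

primrec subst_tm :: "tm \<Rightarrow> nat \<Rightarrow> tm \<Rightarrow> tm" where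
  "subst_tm (Const c) w t = Const c"
| "subst_tm (Var x) w t = (if x = w then t else Var x)"
| "subst_tm (r \<odot> s) w t = subst_tm r w t \<odot> subst_tm s w t"
| "subst_tm (r \<oplus> s) w t = subst_tm r w t \<oplus> subst_tm s w t"

primrec subst :: "'p fm \<Rightarrow> nat \<Rightarrow> tm \<Rightarrow> 'p fm" where
  "subst Bot w t = Bot"
| "subst (Atom P) w t = Atom P"
| "subst (A \<rightarrow>\<^sub>j B) w t = subst A w t \<rightarrow>\<^sub>j subst B w t"
| "subst (Just s A) w t = Just (subst_tm s w t) (subst A w t)"

section \<open>Axioms and derivability\<close>

text \<open>
  For propositional purposes, formulas \<open>Just t A\<close> count as atoms; the valuation \<open>v\<close> is only
  consulted on \<open>Atom P\<close> and \<open>Just t A\<close>.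
\<close>

primrec prop_eval :: "('p fm \<Rightarrow> bool) \<Rightarrow> 'p fm \<Rightarrow> bool" where
  "prop_eval v Bot = False"
| "prop_eval v (Atom P) = v (Atom P)"
| "prop_eval v (A \<rightarrow>\<^sub>j B) = (prop_eval v A \<longrightarrow> prop_eval v B)"
| "prop_eval v (Just t A) = v (Just t A)"

definition tautology :: "'p fm \<Rightarrow> bool" where
  "tautology A \<longleftrightarrow> (\<forall>v. prop_eval v A)"

text \<open>The two equivalences of (a0), and likewise of (a1), are separate schemes.\<close>

datatype scheme =
  CL | J | JPlus | APlus | CPlus | ZeroPlus | AM | A0_right | A0_left | A1_right | A1_left | DL | DR

inductive instance_of :: "scheme \<Rightarrow> 'p fm \<Rightarrow> bool" where
  "tautology A \<Longrightarrow> instance_of CL A"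
| "instance_of J
     (Just (Var x) (A \<rightarrow>\<^sub>j B) \<rightarrow>\<^sub>j (Just (Var y) A \<rightarrow>\<^sub>j Just (Var x \<odot> Var y) B))"
| "instance_of JPlus
     (Just (Var x) A \<and>\<^sub>j Just (Var y) A \<rightarrow>\<^sub>j Just (Var x \<oplus> Var y) A)"
| "instance_of APlus
     (subst A w ((Var x \<oplus> Var y) \<oplus> Var z) \<rightarrow>\<^sub>j subst A w (Var x \<oplus> (Var y \<oplus> Var z)))"
| "instance_of CPlus
     (subst A w (Var x \<oplus> Var y) \<rightarrow>\<^sub>j subst A w (Var y \<oplus> Var x))"
| "instance_of ZeroPlus (subst A w (Var x \<oplus> \<^bold>0) \<leftrightarrow>\<^sub>j subst A w (Var x))"
| "instance_of AM
     (subst A w ((Var x \<odot> Var y) \<odot> Var z) \<leftrightarrow>\<^sub>j subst A w (Var x \<odot> (Var y \<odot> Var z)))"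
| "instance_of A0_right (subst A w (Var x \<odot> \<^bold>0) \<leftrightarrow>\<^sub>j subst A w \<^bold>0)"
| "instance_of A0_left (subst A w (\<^bold>0 \<odot> Var x) \<leftrightarrow>\<^sub>j subst A w \<^bold>0)"
| "instance_of A1_right (subst A w (Var x \<odot> \<^bold>1) \<leftrightarrow>\<^sub>j subst A w (Var x))"
| "instance_of A1_left (subst A w (\<^bold>1 \<odot> Var x) \<leftrightarrow>\<^sub>j subst A w (Var x))"
| "instance_of DL
     (subst A w (Var x \<odot> (Var y \<oplus> Var z)) \<leftrightarrow>\<^sub>j subst A w (Var x \<odot> Var y \<oplus> Var x \<odot> Var z))"
| "instance_of DR
     (subst A w ((Var y \<oplus> Var z) \<odot> Var x) \<leftrightarrow>\<^sub>j subst A w (Var y \<odot> Var x \<oplus> Var z \<odot> Var x))"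

definition SE_axiom :: "'p fm \<Rightarrow> bool" where
  "SE_axiom A \<longleftrightarrow> (\<exists>s. instance_of s A)"

inductive SE_derives :: "'p fm set \<Rightarrow> 'p fm \<Rightarrow> bool"  (infix \<open>\<turnstile>\<^sub>S\<^sub>E\<close> 45) for T where
  ax: "SE_axiom A \<Longrightarrow> T \<turnstile>\<^sub>S\<^sub>E A"
| mem: "A \<in> T \<Longrightarrow> T \<turnstile>\<^sub>S\<^sub>E A"
| mp: "T \<turnstile>\<^sub>S\<^sub>E A \<rightarrow>\<^sub>j B \<Longrightarrow> T \<turnstile>\<^sub>S\<^sub>E A \<Longrightarrow> T \<turnstile>\<^sub>S\<^sub>E B"
| jv: "T \<turnstile>\<^sub>S\<^sub>E A \<Longrightarrow> T \<turnstile>\<^sub>S\<^sub>E subst A x t"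

definition axiomatically_appropriate :: "'p fm set \<Rightarrow> bool" where
  "axiomatically_appropriate T \<longleftrightarrow>
     (\<forall>A. SE_axiom A \<longrightarrow> (\<exists>c. Just (Const c) A \<in> T)) \<and>
     (\<forall>B\<in>T. \<exists>c. Just (Const c) B \<in> T)"

definition schematic :: "'p fm set \<Rightarrow> bool" where
  "schematic T \<longleftrightarrow>
     (\<forall>c. \<exists>S :: scheme set.
        {A. Just (Const c) A \<in> T \<and> SE_axiom A} = {A. \<exists>s\<in>S. instance_of s A})"

section \<open>The modal logic K\<close>

datatype 'p mfm =
    MBot
  | MAtom 'p
  | MImp "'p mfm" "'p mfm"  (infixr \<open>\<rightarrow>\<^sub>m\<close> 55)
  | Box "'p mfm"

primrec mprop_eval :: "('p mfm \<Rightarrow> bool) \<Rightarrow> 'p mfm \<Rightarrow> bool" where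
  "mprop_eval v MBot = False"
| "mprop_eval v (MAtom P) = v (MAtom P)"
| "mprop_eval v (F \<rightarrow>\<^sub>m G) = (mprop_eval v F \<longrightarrow> mprop_eval v G)"
| "mprop_eval v (Box F) = v (Box F)"

definition mtautology :: "'p mfm \<Rightarrow> bool" where
  "mtautology F \<longleftrightarrow> (\<forall>v. mprop_eval v F)"

inductive K_derives :: "'p mfm \<Rightarrow> bool"  (\<open>\<turnstile>\<^sub>K _\<close> [46] 45) where
  taut: "mtautology F \<Longrightarrow> \<turnstile>\<^sub>K F"
| K: "\<turnstile>\<^sub>K Box (F \<rightarrow>\<^sub>m G) \<rightarrow>\<^sub>m (Box F \<rightarrow>\<^sub>m Box G)"
| mp: "\<turnstile>\<^sub>K F \<rightarrow>\<^sub>m G \<Longrightarrow> \<turnstile>\<^sub>K F \<Longrightarrow> \<turnstile>\<^sub>K G"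
| nec: "\<turnstile>\<^sub>K F \<Longrightarrow> \<turnstile>\<^sub>K Box F"

section \<open>Normal realizations\<close>

primrec forget :: "'p fm \<Rightarrow> 'p mfm" where
  "forget Bot = MBot"
| "forget (Atom P) = MAtom P"
| "forget (A \<rightarrow>\<^sub>j B) = forget A \<rightarrow>\<^sub>m forget B"
| "forget (Just t A) = Box (forget A)"

definition realization :: "('p mfm \<Rightarrow> 'p fm) \<Rightarrow> bool" where
  "realization r \<longleftrightarrow> (\<forall>F. forget (r F) = F)"

text \<open>
  An occurrence of a subformula is identified by the path leading to it from the root.
  \<open>occ F p b G\<close>: at path \<open>p\<close>, \<open>F\<close> has an occurrence of \<open>G\<close>, which is positive if \<open>b\<close>
  and negative otherwise.
\<close>

datatype step = ImpL | ImpR | Under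

inductive occ :: "'p mfm \<Rightarrow> step list \<Rightarrow> bool \<Rightarrow> 'p mfm \<Rightarrow> bool" for F where
  root: "occ F [] True F"
| impR: "occ F p b (G \<rightarrow>\<^sub>m H) \<Longrightarrow> occ F (p @ [ImpR]) b H"
| impL: "occ F p b (G \<rightarrow>\<^sub>m H) \<Longrightarrow> occ F (p @ [ImpL]) (\<not> b) G"
| under: "occ F p b (Box G) \<Longrightarrow> occ F (p @ [Under]) b G"

definition negative_boxes :: "'p mfm \<Rightarrow> step list set" where
  "negative_boxes F = {p. \<exists>G. occ F p False (Box G)}"

text \<open>The term \<open>t\<close> of the subformula \<open>Just t A\<close> at a given path, if there is one.\<close>

fun term_at :: "'p fm \<Rightarrow> step list \<Rightarrow> tm option" where
  "term_at (Just t A) [] = Some t"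
| "term_at (Just t A) (Under # p) = term_at A p"
| "term_at (A \<rightarrow>\<^sub>j B) (ImpL # p) = term_at A p"
| "term_at (A \<rightarrow>\<^sub>j B) (ImpR # p) = term_at B p"
| "term_at _ _ = None"

definition normal_realization :: "('p mfm \<Rightarrow> 'p fm) \<Rightarrow> bool" where
  "normal_realization r \<longleftrightarrow> realization r \<and>
     (\<forall>F. \<exists>x :: step list \<Rightarrow> nat. inj_on x (negative_boxes F) \<and>
        (\<forall>p\<in>negative_boxes F. term_at (r F) p = Some (Var (x p))))"

end

theory Submission
  imports Defs
begin

text \<open>
  Since a schematic theory has one constant \<open>d\<close> for all tautologies, in particular for all
  \<open>A \<or>\<^sub>j A \<rightarrow>\<^sub>j A\<close>, the term \<open>d \<odot> (c \<odot> s \<odot> t)\<close> justifies everything that \<open>s\<close> or \<open>t\<close> justifies.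
  With it one can realize a cut-free derivation rule by rule, as in Artemov's realization theorem:
  the term of a positive box is an iterated join with one component for each rule introducing
  that box, namely \<open>k \<odot> x1 \<odot> \<dots> \<odot> xn\<close> where \<open>k\<close> is a closed term internalizing the premise and
  the \<open>xi\<close> are the variables of the negative boxes involved. Cut-free completeness is shown
  semantically, with finite trees as countermodels.
\<close>

section \<open>Simultaneous substitution\<close>

primrec vars_tm :: "tm \<Rightarrow> nat set" where
  "vars_tm (Const c) = {}"
| "vars_tm (Var x) = {x}"
| "vars_tm (s \<odot> t) = vars_tm s \<union> vars_tm t"
| "vars_tm (s \<oplus> t) = vars_tm s \<union> vars_tm t"

primrec vars_fm :: "'p fm \<Rightarrow> nat set" where
  "vars_fm Bot = {}"
| "vars_fm (Atom P) = {}"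
| "vars_fm (A \<rightarrow>\<^sub>j B) = vars_fm A \<union> vars_fm B"
| "vars_fm (Just t A) = vars_tm t \<union> vars_fm A"

primrec ssubst_tm :: "(nat \<Rightarrow> tm) \<Rightarrow> tm \<Rightarrow> tm" where
  "ssubst_tm \<sigma> (Const c) = Const c"
| "ssubst_tm \<sigma> (Var x) = \<sigma> x"
| "ssubst_tm \<sigma> (s \<odot> t) = ssubst_tm \<sigma> s \<odot> ssubst_tm \<sigma> t"
| "ssubst_tm \<sigma> (s \<oplus> t) = ssubst_tm \<sigma> s \<oplus> ssubst_tm \<sigma> t"

primrec ssubst :: "(nat \<Rightarrow> tm) \<Rightarrow> 'p fm \<Rightarrow> 'p fm" where
  "ssubst \<sigma> Bot = Bot"
| "ssubst \<sigma> (Atom P) = Atom P"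
| "ssubst \<sigma> (A \<rightarrow>\<^sub>j B) = ssubst \<sigma> A \<rightarrow>\<^sub>j ssubst \<sigma> B"
| "ssubst \<sigma> (Just t A) = Just (ssubst_tm \<sigma> t) (ssubst \<sigma> A)"

lemma finite_vars_tm: "finite (vars_tm t)"
  by (induction t) auto

lemma finite_vars_fm: "finite (vars_fm A)"
  by (induction A) (auto simp: finite_vars_tm)

lemma vars_foldl_Dot: "vars_tm (foldl (\<odot>) s ts) = vars_tm s \<union> (\<Union>t\<in>set ts. vars_tm t)"
  by (induction ts arbitrary: s) auto

lemma ssubst_tm_cong: "(\<And>i. i \<in> vars_tm t \<Longrightarrow> \<sigma> i = \<tau> i) \<Longrightarrow> ssubst_tm \<sigma> t = ssubst_tm \<tau> t"
  by (induction t) auto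

lemma ssubst_cong: "(\<And>i. i \<in> vars_fm A \<Longrightarrow> \<sigma> i = \<tau> i) \<Longrightarrow> ssubst \<sigma> A = ssubst \<tau> A"
  by (induction A) (auto intro!: ssubst_tm_cong)

lemma ssubst_tm_Var [simp]: "ssubst_tm Var t = t"
  by (induction t) auto

lemma ssubst_Var [simp]: "ssubst Var A = A"
  by (induction A) auto

lemma ssubst_tm_ssubst_tm: "ssubst_tm \<tau> (ssubst_tm \<sigma> t) = ssubst_tm (\<lambda>i. ssubst_tm \<tau> (\<sigma> i)) t"
  by (induction t) auto

lemma ssubst_ssubst: "ssubst \<tau> (ssubst \<sigma> A) = ssubst (\<lambda>i. ssubst_tm \<tau> (\<sigma> i)) A"
  by (induction A) (auto simp: ssubst_tm_ssubst_tm)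

lemma subst_tm_eq_ssubst_tm: "subst_tm s w t = ssubst_tm (\<lambda>i. if i = w then t else Var i) s"
  by (induction s) auto

lemma subst_eq_ssubst: "subst A w t = ssubst (\<lambda>i. if i = w then t else Var i) A"
  by (induction A) (auto simp: subst_tm_eq_ssubst_tm)

lemma ssubst_tm_idle: "(\<And>i. i \<in> vars_tm t \<Longrightarrow> \<sigma> i = Var i) \<Longrightarrow> ssubst_tm \<sigma> t = t"
  by (metis ssubst_tm_Var ssubst_tm_cong)

text \<open>The rule \<open>jv\<close> replaces one variable at a time. As no
  \<open>\<sigma> i\<close> with \<open>i\<close> in \<open>V\<close> contains a variable of
  \<open>V\<close>, later replacements leave the terms inserted earlier untouched, so iterating
  \<open>jv\<close> over \<open>V\<close> yields the simultaneous substitution.\<close>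

lemma SE_derives_ssubst_disjoint:
  assumes "T \<turnstile>\<^sub>S\<^sub>E A" "finite V" "\<And>i. i \<in> V \<Longrightarrow> vars_tm (\<sigma> i) \<inter> V = {}"
  shows "T \<turnstile>\<^sub>S\<^sub>E ssubst (\<lambda>i. if i \<in> V then \<sigma> i else Var i) A"
  using assms(2,3)
proof (induction V rule: finite_induct)
  case empty
  then show ?case using assms(1) by simp
next
  case (insert a V)
  have "T \<turnstile>\<^sub>S\<^sub>E subst (ssubst (\<lambda>i. if i \<in> V then \<sigma> i else Var i) A) a (\<sigma> a)"
    using insert by (intro SE_derives.jv insert.IH) blast
  moreover have "ssubst_tm (\<lambda>i. if i = a then \<sigma> a else Var i) (\<sigma> i) = \<sigma> i" if "i \<in> V" for i
    using that insert.prems[of i] by (intro ssubst_tm_idle) auto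
  then have "subst (ssubst (\<lambda>i. if i \<in> V then \<sigma> i else Var i) A) a (\<sigma> a)
      = ssubst (\<lambda>i. if i \<in> insert a V then \<sigma> i else Var i) A"
    using insert.hyps by (auto simp: subst_eq_ssubst ssubst_ssubst intro!: ssubst_cong)
  ultimately show ?case by simp
qed

text \<open>First rename the variables away from those of the substituted terms; then the order
  of the single substitutions does not matter.\<close>

lemma SE_derives_ssubst:
  assumes "T \<turnstile>\<^sub>S\<^sub>E A"
  shows "T \<turnstile>\<^sub>S\<^sub>E ssubst \<sigma> A"
proof -
  define W where "W = vars_fm A \<union> (\<Union>i\<in>vars_fm A. vars_tm (\<sigma> i))"
  have "finite W" by (auto simp: W_def finite_vars_fm finite_vars_tm)
  then obtain N where N: "\<And>i. i \<in> W \<Longrightarrow> i < N"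
    by (meson finite_nat_set_iff_bounded)
  define V where "V = (\<lambda>i. i + N) ` vars_fm A"
  let ?A = "ssubst (\<lambda>i. if i \<in> vars_fm A then Var (i + N) else Var i) A"
  have "T \<turnstile>\<^sub>S\<^sub>E ?A"
    using N by (intro SE_derives_ssubst_disjoint assms finite_vars_fm) (force simp: W_def)
  then have "T \<turnstile>\<^sub>S\<^sub>E ssubst (\<lambda>i. if i \<in> V then \<sigma> (i - N) else Var i) ?A"
    by (rule SE_derives_ssubst_disjoint) (use N in \<open>force simp: W_def V_def finite_vars_fm\<close>)+
  also have "ssubst (\<lambda>i. if i \<in> V then \<sigma> (i - N) else Var i) ?A = ssubst \<sigma> A"
    by (auto simp: ssubst_ssubst V_def intro!: ssubst_cong)
  finally show ?thesis .
qed

section \<open>Propositional reasoning and internalization\<close>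

lemma SE_derives_taut_mp:
  assumes "T \<turnstile>\<^sub>S\<^sub>E A" "\<And>v. prop_eval v A \<Longrightarrow> prop_eval v B"
  shows "T \<turnstile>\<^sub>S\<^sub>E B"
proof -
  have "SE_axiom (A \<rightarrow>\<^sub>j B)"
    using assms(2) by (auto simp: SE_axiom_def tautology_def intro!: exI[of _ CL] instance_of.intros(1))
  then show ?thesis using SE_derives.mp[OF SE_derives.ax assms(1)] by blast
qed

lemma SE_derives_taut_mp2:
  assumes "T \<turnstile>\<^sub>S\<^sub>E A" "T \<turnstile>\<^sub>S\<^sub>E B" "\<And>v. prop_eval v A \<Longrightarrow> prop_eval v B \<Longrightarrow> prop_eval v D"
  shows "T \<turnstile>\<^sub>S\<^sub>E D"
  using SE_derives.mp[OF SE_derives_taut_mp[OF assms(1), of "B \<rightarrow>\<^sub>j D"] assms(2)] assms(3) by simp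

lemma SE_derives_tautology: "(\<And>v. prop_eval v A) \<Longrightarrow> T \<turnstile>\<^sub>S\<^sub>E A"
  by (auto simp: SE_axiom_def tautology_def intro!: SE_derives.ax exI[of _ CL] instance_of.intros(1))

lemma prop_eval_Imps [simp]:
  "prop_eval v (foldr (\<rightarrow>\<^sub>j) As B) \<longleftrightarrow> ((\<forall>A\<in>set As. prop_eval v A) \<longrightarrow> prop_eval v B)"
  by (induction As) auto

lemma prop_eval_Ors [simp]:
  "prop_eval v (foldr (\<or>\<^sub>j) As Bot) \<longleftrightarrow> (\<exists>A\<in>set As. prop_eval v A)"
  by (induction As) auto

text \<open>Scheme \<open>J\<close> speaks of variables only. It is taken for two variables that do
  not occur in \<open>A\<close> or \<open>B\<close>, so inserting \<open>s\<close> and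
  \<open>t\<close> for them leaves \<open>A\<close> and \<open>B\<close> as they are.\<close>

lemma SE_derives_application:
  "T \<turnstile>\<^sub>S\<^sub>E Just s (A \<rightarrow>\<^sub>j B) \<rightarrow>\<^sub>j (Just t A \<rightarrow>\<^sub>j Just (s \<odot> t) B)"
proof -
  define N where "N = Suc (Max (insert 0 (vars_fm (A \<rightarrow>\<^sub>j B))))"
  have N: "i < N" if "i \<in> vars_fm (A \<rightarrow>\<^sub>j B)" for i
    using that finite_vars_fm[of "A \<rightarrow>\<^sub>j B"] unfolding N_def by (metis Max_ge finite_insert insertI2 le_imp_less_Suc)
  let ?\<sigma> = "Var(N := s, Suc N := t)"
  have "T \<turnstile>\<^sub>S\<^sub>E Just (Var N) (A \<rightarrow>\<^sub>j B) \<rightarrow>\<^sub>j (Just (Var (Suc N)) A \<rightarrow>\<^sub>j Just (Var N \<odot> Var (Suc N)) B)"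
    by (auto simp: SE_axiom_def intro!: SE_derives.ax exI[of _ J] instance_of.intros)
  from SE_derives_ssubst[OF this, of ?\<sigma>]
  have "T \<turnstile>\<^sub>S\<^sub>E Just s (ssubst ?\<sigma> A \<rightarrow>\<^sub>j ssubst ?\<sigma> B) \<rightarrow>\<^sub>j (Just t (ssubst ?\<sigma> A) \<rightarrow>\<^sub>j Just (s \<odot> t) (ssubst ?\<sigma> B))"
    by simp
  moreover have "ssubst ?\<sigma> A = ssubst Var A" "ssubst ?\<sigma> B = ssubst Var B"
    using N by (fastforce intro!: ssubst_cong)+
  ultimately show ?thesis by simp
qed

lemma SE_derives_application_list:
  "T \<turnstile>\<^sub>S\<^sub>E Just s (foldr (\<rightarrow>\<^sub>j) (map f xs) B) \<rightarrow>\<^sub>j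
     foldr (\<rightarrow>\<^sub>j) (map (\<lambda>a. Just (g a) (f a)) xs) (Just (foldl (\<odot>) s (map g xs)) B)"
proof (induction xs arbitrary: s)
  case Nil
  show ?case by (simp add: SE_derives_tautology)
next
  case (Cons a xs)
  show ?case
    by (rule SE_derives_taut_mp2[OF SE_derives_application[of T s "f a" "foldr (\<rightarrow>\<^sub>j) (map f xs) B" "g a"]
          Cons.IH[of "s \<odot> g a"]]) auto
qed

text \<open>The term mirrors the derivation: constants at the leaves, application for modus ponens,
  no change for \<open>jv\<close>. It is closed, hence fixed by every substitution, so one
  \<open>k\<close> justifies all substitution instances of \<open>A\<close>.\<close>

lemma internalization:
  assumes "axiomatically_appropriate T" "T \<turnstile>\<^sub>S\<^sub>E A"
  shows "\<exists>k. vars_tm k = {} \<and> (\<forall>\<sigma>. T \<turnstile>\<^sub>S\<^sub>E Just k (ssubst \<sigma> A))"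
proof -
  have "\<exists>k. vars_tm k = {} \<and> T \<turnstile>\<^sub>S\<^sub>E Just k A"
    using assms(2)
  proof (induction rule: SE_derives.induct)
    case (ax A)
    then obtain c where "Just (Const c) A \<in> T"
      using assms(1) by (auto simp: axiomatically_appropriate_def)
    then show ?case by (intro exI[of _ "Const c"]) (simp add: SE_derives.mem)
  next
    case (mem A)
    then obtain c where "Just (Const c) A \<in> T"
      using assms(1) by (auto simp: axiomatically_appropriate_def)
    then show ?case by (intro exI[of _ "Const c"]) (simp add: SE_derives.mem)
  next
    case (mp A B)
    then obtain s t where "vars_tm s = {}" "T \<turnstile>\<^sub>S\<^sub>E Just s (A \<rightarrow>\<^sub>j B)" "vars_tm t = {}" "T \<turnstile>\<^sub>S\<^sub>E Just t A"
      by blast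
    then show ?case
      using SE_derives.mp[OF SE_derives.mp[OF SE_derives_application]]
      by (intro exI[of _ "s \<odot> t"]) auto
  next
    case (jv A x t)
    then obtain s where s: "vars_tm s = {}" "T \<turnstile>\<^sub>S\<^sub>E Just s A" by blast
    then have "T \<turnstile>\<^sub>S\<^sub>E Just (subst_tm s x t) (subst A x t)"
      using SE_derives.jv[OF s(2), of x t] by simp
    moreover have "subst_tm s x t = s"
      unfolding subst_tm_eq_ssubst_tm using s(1) by (intro ssubst_tm_idle) simp
    ultimately show ?case using s(1) by auto
  qed
  then obtain k where k: "vars_tm k = {}" "T \<turnstile>\<^sub>S\<^sub>E Just k A" by blast
  moreover have "ssubst_tm \<sigma> k = k" for \<sigma>
    using k(1) by (intro ssubst_tm_idle) simp
  ultimately show ?thesis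
    using SE_derives_ssubst[OF k(2)] by auto
qed

text \<open>The tautology \<open>Bot \<rightarrow>\<^sub>j (Bot \<rightarrow>\<^sub>j Bot)\<close> is an instance of no scheme but CL, so a constant
  justifying it must justify every instance of CL.\<close>

lemma schematic_CL_constant:
  fixes T :: "'p fm set"
  assumes "axiomatically_appropriate T" "schematic T"
  shows "\<exists>d. \<forall>A. tautology A \<longrightarrow> Just (Const d) A \<in> T"
proof -
  let ?E = "Bot \<rightarrow>\<^sub>j (Bot \<rightarrow>\<^sub>j Bot) :: 'p fm"
  have "SE_axiom ?E"
    by (auto simp: SE_axiom_def tautology_def intro!: exI[of _ CL] instance_of.intros(1))
  then obtain d where d: "Just (Const d) ?E \<in> T"
    using assms(1) by (auto simp: axiomatically_appropriate_def)
  obtain S :: "scheme set" where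
    S: "{A. Just (Const d) A \<in> T \<and> SE_axiom A} = {A. \<exists>s\<in>S. instance_of s A}"
    using assms(2) unfolding schematic_def by blast
  then obtain s where s: "s \<in> S" "instance_of s ?E"
    using d \<open>SE_axiom ?E\<close> by blast
  \<comment> \<open>This excludes the substitution schemes: in \<open>APlus\<close> and
    \<open>CPlus\<close> an antecedent \<open>Bot\<close> would force the consequent to be
    \<open>Bot\<close> too, and an equivalence unfolds to an implication whose antecedent is not
    \<open>Bot\<close>.\<close>
  have Bot: "subst A w t = Bot \<longleftrightarrow> A = Bot" for A :: "'p fm" and w t
    by (cases A) auto
  have "s = CL"
    using s(2) by (cases rule: instance_of.cases) (auto simp: Bot dest: Bot[THEN iffD1, OF sym])
  then show ?thesis
    using S s(1) by (blast intro: instance_of.intros(1))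
qed

section \<open>Finite trees as Kripke models\<close>

datatype 'p ktree = Node "'p set" "'p ktree list"

fun forces :: "'p ktree \<Rightarrow> 'p mfm \<Rightarrow> bool" where
  "forces M MBot = False"
| "forces (Node V Ms) (MAtom P) \<longleftrightarrow> P \<in> V"
| "forces M (F \<rightarrow>\<^sub>m G) \<longleftrightarrow> (forces M F \<longrightarrow> forces M G)"
| "forces (Node V Ms) (Box F) \<longleftrightarrow> (\<forall>M\<in>set Ms. forces M F)"

lemma mprop_eval_forces: "mprop_eval (forces M) F = forces M F"
  by (induction F) auto

lemma K_sound: "\<turnstile>\<^sub>K F \<Longrightarrow> forces M F"
proof (induction arbitrary: M rule: K_derives.induct)
  case (taut F)
  then show ?case by (metis mprop_eval_forces mtautology_def)
next
  case (K F G)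
  show ?case by (cases M) auto
next
  case (mp F G)
  then show ?case by simp
next
  case (nec F)
  then show ?case by (cases M) auto
qed

section \<open>A cut-free calculus for annotated formulas\<close>

datatype 'p afm = ABot | AAtom 'p | AImp "'p afm" "'p afm" | ABox nat "'p afm"

primrec erase :: "'p afm \<Rightarrow> 'p mfm" where
  "erase ABot = MBot"
| "erase (AAtom P) = MAtom P"
| "erase (AImp A B) = erase A \<rightarrow>\<^sub>m erase B"
| "erase (ABox n A) = Box (erase A)"

fun unbox :: "'p afm list \<Rightarrow> (nat \<times> 'p afm) list" where
  "unbox [] = []"
| "unbox (ABox n A # \<Gamma>) = (n, A) # unbox \<Gamma>"
| "unbox (A # \<Gamma>) = unbox \<Gamma>"

lemma set_unbox: "(n, A) \<in> set (unbox \<Gamma>) \<longleftrightarrow> ABox n A \<in> set \<Gamma>"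
  by (induction \<Gamma> rule: unbox.induct) auto

text \<open>Initial sequents are restricted to atoms: the two occurrences of a non-atomic formula
  may be annotated differently.\<close>

inductive seq :: "'p afm list \<Rightarrow> 'p afm list \<Rightarrow> bool" where
  init: "AAtom P \<in> set \<Gamma> \<Longrightarrow> AAtom P \<in> set \<Delta> \<Longrightarrow> seq \<Gamma> \<Delta>"
| bot: "ABot \<in> set \<Gamma> \<Longrightarrow> seq \<Gamma> \<Delta>"
| impR: "AImp A B \<in> set \<Delta> \<Longrightarrow> set \<Delta>' \<subseteq> set \<Delta> \<Longrightarrow> seq (A # \<Gamma>) (B # \<Delta>') \<Longrightarrow> seq \<Gamma> \<Delta>"
| impL: "AImp A B \<in> set \<Gamma> \<Longrightarrow> set \<Gamma>' \<subseteq> set \<Gamma> \<Longrightarrow> seq \<Gamma>' (A # \<Delta>) \<Longrightarrow> seq (B # \<Gamma>') \<Delta> \<Longrightarrow> seq \<Gamma> \<Delta>"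
| box: "ABox n B \<in> set \<Delta> \<Longrightarrow> seq (map snd (unbox \<Gamma>)) [B] \<Longrightarrow> seq \<Gamma> \<Delta>"

definition refutes :: "'p ktree \<Rightarrow> 'p afm list \<Rightarrow> 'p afm list \<Rightarrow> bool" where
  "refutes M \<Gamma> \<Delta> \<longleftrightarrow> (\<forall>A\<in>set \<Gamma>. forces M (erase A)) \<and> (\<forall>A\<in>set \<Delta>. \<not> forces M (erase A))"

lemma size_unbox: "sum_list (map size (map snd (unbox \<Gamma>))) \<le> sum_list (map size \<Gamma>)"
  by (induction \<Gamma> rule: unbox.induct) auto

lemma sum_list_size_remove1:
  "A \<in> set \<Gamma> \<Longrightarrow> sum_list (map size \<Gamma>) = size A + sum_list (map size (remove1 A \<Gamma>))"
  by (simp add: sum_list_map_remove1)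

text \<open>Backward proof search by induction on total size. The implication rules are invertible:
  a tree refuting a premise refutes the conclusion. Without implications left, either a rule closes
  the sequent or trees refuting the premises of all possible \<open>box\<close> steps can be put
  under one root.\<close>

lemma seq_complete: "seq \<Gamma> \<Delta> \<or> (\<exists>M. refutes M \<Gamma> \<Delta>)"
proof (induction "sum_list (map size \<Gamma>) + sum_list (map size \<Delta>)" arbitrary: \<Gamma> \<Delta> rule: less_induct)
  case less
  consider (R) A B where "AImp A B \<in> set \<Delta>" | (L) A B where "AImp A B \<in> set \<Gamma>"
    | (atomic) "\<And>A B. AImp A B \<notin> set \<Gamma>" "\<And>A B. AImp A B \<notin> set \<Delta>"
    by blast
  then show ?case
  proof cases
    case R
    let ?\<Delta> = "remove1 (AImp A B) \<Delta>"
    have "seq (A # \<Gamma>) (B # ?\<Delta>) \<or> (\<exists>M. refutes M (A # \<Gamma>) (B # ?\<Delta>))"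
      by (rule less) (simp add: sum_list_size_remove1[OF R])
    moreover have "refutes M \<Gamma> \<Delta>" if "refutes M (A # \<Gamma>) (B # ?\<Delta>)" for M
    proof -
      have "D = AImp A B \<or> D \<in> set ?\<Delta>" if "D \<in> set \<Delta>" for D
        using that by (metis in_set_remove1)
      then show ?thesis using that by (fastforce simp: refutes_def)
    qed
    ultimately show ?thesis using R by (meson seq.impR set_remove1_subset)
  next
    case L
    let ?\<Gamma> = "remove1 (AImp A B) \<Gamma>"
    have in_\<Gamma>: "D = AImp A B \<or> D \<in> set ?\<Gamma>" if "D \<in> set \<Gamma>" for D
      using that by (metis in_set_remove1)
    have "seq ?\<Gamma> (A # \<Delta>) \<or> (\<exists>M. refutes M ?\<Gamma> (A # \<Delta>))"
      by (rule less) (simp add: sum_list_size_remove1[OF L])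
    moreover have "seq (B # ?\<Gamma>) \<Delta> \<or> (\<exists>M. refutes M (B # ?\<Gamma>) \<Delta>)"
      by (rule less) (simp add: sum_list_size_remove1[OF L])
    moreover have "refutes M \<Gamma> \<Delta>" if "refutes M ?\<Gamma> (A # \<Delta>) \<or> refutes M (B # ?\<Gamma>) \<Delta>" for M
      using that in_\<Gamma> by (fastforce simp: refutes_def)
    ultimately show ?thesis using L by (meson seq.impL set_remove1_subset)
  next
    case atomic
    show ?thesis
    proof (rule disjCI)
      assume "\<nexists>M. refutes M \<Gamma> \<Delta>"
      show "seq \<Gamma> \<Delta>"
      proof (rule ccontr)
        assume ns: "\<not> seq \<Gamma> \<Delta>"
        have "\<exists>M. refutes M (map snd (unbox \<Gamma>)) [B]" if B: "ABox n B \<in> set \<Delta>" for n B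
        proof -
          have "size B < sum_list (map size \<Delta>)"
            by (simp add: sum_list_size_remove1[OF B])
          then have "seq (map snd (unbox \<Gamma>)) [B] \<or> (\<exists>M. refutes M (map snd (unbox \<Gamma>)) [B])"
            using size_unbox[of \<Gamma>] by (intro less) simp
          then show ?thesis using ns seq.box[OF B] by blast
        qed
        \<comment> \<open>The index \<open>n\<close> is quantified inside, so the chosen tree
          depends on \<open>B\<close> alone; the premise of \<open>box\<close> does not mention the
          index either.\<close>
        then have "\<exists>M. (\<exists>n. ABox n B \<in> set \<Delta>) \<longrightarrow> refutes M (map snd (unbox \<Gamma>)) [B]" for B
          by blast
        then obtain f where f: "\<And>n B. ABox n B \<in> set \<Delta> \<Longrightarrow> refutes (f B) (map snd (unbox \<Gamma>)) [B]"
          by metis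
        let ?M = "Node {P. AAtom P \<in> set \<Gamma>} (map (f \<circ> snd) (unbox \<Delta>))"
        have "forces ?M (erase A)" if "A \<in> set \<Gamma>" for A
        proof (cases A)
          case ABot
          then show ?thesis using that ns seq.bot by blast
        next
          case (ABox n B)
          then have "B \<in> snd ` set (unbox \<Gamma>)" using that by (force simp: set_unbox[symmetric])
          then have "forces (f D) (erase B)" if "(m, D) \<in> set (unbox \<Delta>)" for m D
            using f[of m D] that by (auto simp: set_unbox refutes_def)
          then show ?thesis using ABox by auto
        qed (use that atomic in auto)
        moreover have "\<not> forces ?M (erase A)" if "A \<in> set \<Delta>" for A
        proof (cases A)
          case (AAtom P)
          then show ?thesis using that ns seq.init[of P \<Gamma> \<Delta>] by auto
        next
          case (ABox n B)
          then have "(n, B) \<in> set (unbox \<Delta>)" "\<not> forces (f B) (erase B)"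
            using that f by (auto simp: set_unbox refutes_def)
          then show ?thesis using ABox by force
        qed (use that atomic in auto)
        ultimately have "refutes ?M \<Gamma> \<Delta>" by (simp add: refutes_def)
        then show False using \<open>\<nexists>M. refutes M \<Gamma> \<Delta>\<close> by blast
      qed
    qed
  qed
qed

section \<open>Realizing annotated formulas\<close>

text \<open>A negative box with index \<open>n\<close> is realized by the variable \<open>2 * n\<close>, a positive one by \<open>\<rho> n\<close>.
  The odd variables are reserved for the yet undetermined parts of the terms \<open>\<rho> n\<close>.\<close>

primrec realize :: "(nat \<Rightarrow> tm) \<Rightarrow> bool \<Rightarrow> 'p afm \<Rightarrow> 'p fm" where
  "realize \<rho> b ABot = Bot"
| "realize \<rho> b (AAtom P) = Atom P"
| "realize \<rho> b (AImp A B) = realize \<rho> (\<not> b) A \<rightarrow>\<^sub>j realize \<rho> b B"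
| "realize \<rho> b (ABox n A) = Just (if b then \<rho> n else Var (2 * n)) (realize \<rho> b A)"

definition realize_seq :: "(nat \<Rightarrow> tm) \<Rightarrow> 'p afm list \<Rightarrow> 'p afm list \<Rightarrow> 'p fm" where
  "realize_seq \<rho> \<Gamma> \<Delta> =
     foldr (\<rightarrow>\<^sub>j) (map (realize \<rho> False) \<Gamma>) (foldr (\<or>\<^sub>j) (map (realize \<rho> True) \<Delta>) Bot)"

lemma prop_eval_realize_seq [simp]:
  "prop_eval v (realize_seq \<rho> \<Gamma> \<Delta>) \<longleftrightarrow>
     ((\<forall>A\<in>set \<Gamma>. prop_eval v (realize \<rho> False A)) \<longrightarrow> (\<exists>A\<in>set \<Delta>. prop_eval v (realize \<rho> True A)))"
  by (simp add: realize_seq_def)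

lemma ssubst_realize:
  assumes "\<And>n. \<sigma> (2 * n) = Var (2 * n)"
  shows "ssubst \<sigma> (realize \<rho> b A) = realize (\<lambda>n. ssubst_tm \<sigma> (\<rho> n)) b A"
  using assms by (induction A arbitrary: b) auto

lemma ssubst_Imps: "ssubst \<sigma> (foldr (\<rightarrow>\<^sub>j) As B) = foldr (\<rightarrow>\<^sub>j) (map (ssubst \<sigma>) As) (ssubst \<sigma> B)"
  by (induction As) auto

text \<open>Terms already fixed may contain only variables of negative boxes, so substituting for
  odd variables changes nothing but the tails.\<close>

definition even_vars :: "(nat \<Rightarrow> tm list) \<Rightarrow> bool" where
  "even_vars L \<longleftrightarrow> (\<forall>n. \<forall>t\<in>set (L n). \<forall>i\<in>vars_tm t. even i)"

text \<open>A term \<open>join d c s t\<close> plays the role of the sum of \<open>s\<close> and \<open>t\<close> in the usual justification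
  logics, where it justifies whatever one of the summands justifies.\<close>

definition join :: "jconst \<Rightarrow> jconst \<Rightarrow> tm \<Rightarrow> tm \<Rightarrow> tm" where
  "join d c s t = Const d \<odot> (Const c \<odot> s \<odot> t)"

locale realizing_theory =
  fixes T :: "'p fm set" and c d :: jconst
  assumes appropriate: "axiomatically_appropriate T"
    and join1: "\<And>s t A. T \<turnstile>\<^sub>S\<^sub>E Just s A \<rightarrow>\<^sub>j Just (join d c s t) A"
    and join2: "\<And>s t A. T \<turnstile>\<^sub>S\<^sub>E Just t A \<rightarrow>\<^sub>j Just (join d c s t) A"
begin

definition joins :: "(nat \<Rightarrow> tm list) \<Rightarrow> (nat \<Rightarrow> tm) \<Rightarrow> nat \<Rightarrow> tm" where
  "joins L \<tau> n = foldr (join d c) (L n) (\<tau> n)"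

text \<open>Adding summands amounts to choosing a particular tail, so whatever is derivable for all
  tails survives every later extension.\<close>

lemma joins_append: "joins (\<lambda>n. L n @ M n) \<tau> = joins L (joins M \<tau>)"
  by (auto simp: joins_def)

lemma joins_member: "s \<in> set (L n) \<Longrightarrow> T \<turnstile>\<^sub>S\<^sub>E Just s A \<rightarrow>\<^sub>j Just (joins L \<tau> n) A"
proof -
  have "s \<in> set xs \<Longrightarrow> T \<turnstile>\<^sub>S\<^sub>E Just s A \<rightarrow>\<^sub>j Just (foldr (join d c) xs u) A" for xs u
  proof (induction xs)
    case (Cons a xs)
    show ?case
    proof (cases "s = a")
      case True
      then show ?thesis by (simp add: join1)
    next
      case False
      then show ?thesis
        using Cons SE_derives_taut_mp2[OF Cons.IH join2[of "foldr (join d c) xs u" A a]] by simp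
    qed
  qed simp
  then show "s \<in> set (L n) \<Longrightarrow> ?thesis" by (simp add: joins_def)
qed

lemma ssubst_tm_joins:
  assumes "even_vars L" "\<And>n. \<sigma> (2 * n) = Var (2 * n)"
  shows "ssubst_tm \<sigma> (joins L \<tau> n) = joins L (\<lambda>n. ssubst_tm \<sigma> (\<tau> n)) n"
proof -
  have "ssubst_tm \<sigma> (foldr (join d c) xs u) = foldr (join d c) xs (ssubst_tm \<sigma> u)"
    if "\<forall>t\<in>set xs. \<forall>i\<in>vars_tm t. even i" for xs u
    using that
  proof (induction xs)
    case (Cons a xs)
    then have "ssubst_tm \<sigma> a = a"
      using assms(2) by (intro ssubst_tm_idle) (auto elim!: evenE)
    then show ?case using Cons by (simp add: join_def)
  qed simp
  then show ?thesis using assms(1) by (simp add: joins_def even_vars_def)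
qed

text \<open>Quantifying over the tails \<open>\<tau>\<close> keeps room for later summands; taking the tails to be
  odd variables makes the internalizing term \<open>k\<close> of a box rule independent of them.\<close>

lemma seq_realizable:
  assumes "seq \<Gamma> \<Delta>" "even_vars L"
  shows "\<exists>M. even_vars M \<and> (\<forall>\<tau>. T \<turnstile>\<^sub>S\<^sub>E realize_seq (joins (\<lambda>n. L n @ M n) \<tau>) \<Gamma> \<Delta>)"
  using assms
proof (induction arbitrary: L rule: seq.induct)
  case (init P \<Gamma> \<Delta>)
  have "T \<turnstile>\<^sub>S\<^sub>E realize_seq \<rho> \<Gamma> \<Delta>" for \<rho>
    using init(1,2) by (intro SE_derives_tautology) (force dest: bspec[of _ _ "AAtom P"] intro: bexI[of _ "AAtom P"])
  then show ?case by (intro exI[of _ "\<lambda>_. []"]) (simp add: even_vars_def)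
next
  case (bot \<Gamma> \<Delta>)
  have "T \<turnstile>\<^sub>S\<^sub>E realize_seq \<rho> \<Gamma> \<Delta>" for \<rho>
    using bot(1) by (intro SE_derives_tautology) force
  then show ?case by (intro exI[of _ "\<lambda>_. []"]) (simp add: even_vars_def)
next
  case (impR A B \<Delta> \<Delta>' \<Gamma>)
  obtain M where M: "even_vars M"
    "\<And>\<tau>. T \<turnstile>\<^sub>S\<^sub>E realize_seq (joins (\<lambda>n. L n @ M n) \<tau>) (A # \<Gamma>) (B # \<Delta>')"
    using impR.IH[OF impR.prems] by blast
  have "T \<turnstile>\<^sub>S\<^sub>E realize_seq (joins (\<lambda>n. L n @ M n) \<tau>) \<Gamma> \<Delta>" for \<tau>
  proof (rule SE_derives_taut_mp[OF M(2)[of \<tau>]])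
    fix v
    let ?\<rho> = "joins (\<lambda>n. L n @ M n) \<tau>"
    assume "prop_eval v (realize_seq ?\<rho> (A # \<Gamma>) (B # \<Delta>'))"
    moreover have "prop_eval v (realize ?\<rho> True (AImp A B)) \<longleftrightarrow>
        (prop_eval v (realize ?\<rho> False A) \<longrightarrow> prop_eval v (realize ?\<rho> True B))"
      by simp
    ultimately show "prop_eval v (realize_seq ?\<rho> \<Gamma> \<Delta>)"
      using impR.hyps(1,2) unfolding prop_eval_realize_seq list.set by blast
  qed
  then show ?case using M(1) by blast
next
  case (impL A B \<Gamma> \<Gamma>' \<Delta>)
  obtain M1 where M1: "even_vars M1"
    "\<And>\<tau>. T \<turnstile>\<^sub>S\<^sub>E realize_seq (joins (\<lambda>n. L n @ M1 n) \<tau>) \<Gamma>' (A # \<Delta>)"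
    using impL.IH(1)[OF impL.prems] by blast
  have "even_vars (\<lambda>n. L n @ M1 n)"
    using impL.prems M1(1) by (auto simp: even_vars_def)
  then obtain M2 where M2: "even_vars M2"
    "\<And>\<tau>. T \<turnstile>\<^sub>S\<^sub>E realize_seq (joins (\<lambda>n. (L n @ M1 n) @ M2 n) \<tau>) (B # \<Gamma>') \<Delta>"
    using impL.IH(2) by blast
  \<comment> \<open>The first premise is used with tail \<open>joins M2 \<tau>\<close>, so that both
    premises are realized by the same terms.\<close>
  have "T \<turnstile>\<^sub>S\<^sub>E realize_seq (joins (\<lambda>n. (L n @ M1 n) @ M2 n) \<tau>) \<Gamma> \<Delta>" for \<tau>
    by (rule SE_derives_taut_mp2[OF M1(2)[of "joins M2 \<tau>", folded joins_append] M2(2)[of \<tau>]])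
      (use impL.hyps in fastforce)
  moreover have "even_vars (\<lambda>n. M1 n @ M2 n)"
    using M1(1) M2(1) by (auto simp: even_vars_def)
  ultimately show ?case
    by (intro exI[of _ "\<lambda>n. M1 n @ M2 n"]) simp
next
  case (box n B \<Delta> \<Gamma>)
  obtain M where M: "even_vars M"
    "\<And>\<tau>. T \<turnstile>\<^sub>S\<^sub>E realize_seq (joins (\<lambda>n. L n @ M n) \<tau>) (map snd (unbox \<Gamma>)) [B]"
    using box.IH[OF box.prems] by blast
  let ?L = "\<lambda>n. L n @ M n"
  let ?imp = "\<lambda>\<rho>. foldr (\<rightarrow>\<^sub>j) (map (\<lambda>(m, A). realize \<rho> False A) (unbox \<Gamma>)) (realize \<rho> True B)"
  have even: "even_vars ?L"
    using box.prems M(1) by (auto simp: even_vars_def)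
  have "T \<turnstile>\<^sub>S\<^sub>E ?imp (joins ?L (\<lambda>n. Var (2 * n + 1)))"
    by (rule SE_derives_taut_mp[OF M(2)]) auto
  then obtain k where k: "vars_tm k = {}"
    "\<And>\<sigma>. T \<turnstile>\<^sub>S\<^sub>E Just k (ssubst \<sigma> (?imp (joins ?L (\<lambda>n. Var (2 * n + 1)))))"
    using internalization[OF appropriate] by blast
  have k_imp: "T \<turnstile>\<^sub>S\<^sub>E Just k (?imp (joins ?L \<tau>))" for \<tau>
  proof -
    \<comment> \<open>The odd variable \<open>2 * n + 1\<close> stands for the tail at
      \<open>n\<close>, and \<open>(2 * n + 1) div 2 = n\<close>.\<close>
    define \<sigma> where "\<sigma> i = (if even i then Var i else \<tau> (i div 2))" for i
    have "ssubst \<sigma> (realize (joins ?L (\<lambda>n. Var (2 * n + 1))) b A) = realize (joins ?L \<tau>) b A"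
      for b and A :: "'p afm"
      by (subst ssubst_realize) (auto simp: \<sigma>_def ssubst_tm_joins[OF even] fun_eq_iff)
    then have "ssubst \<sigma> (?imp (joins ?L (\<lambda>n. Var (2 * n + 1)))) = ?imp (joins ?L \<tau>)"
      by (simp add: ssubst_Imps comp_def case_prod_unfold)
    then show ?thesis using k(2)[of \<sigma>] by simp
  qed
  define s where "s = foldl (\<odot>) k (map (\<lambda>(m, A). Var (2 * m)) (unbox \<Gamma>))"
  \<comment> \<open>Adding \<open>s\<close> changes the term of every box with index
    \<open>n\<close>, possibly also inside \<open>B\<close> or the antecedents. This is not
    circular: \<open>s\<close> depends only on \<open>k\<close> and variables, and
    \<open>k_imp\<close> holds for every tail, in particular for the one starting with
    \<open>s\<close>.\<close>
  define M' where "M' m = M m @ (if m = n then [s] else [])" for m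
  have "\<forall>i\<in>vars_tm s. even i"
    using k(1) by (auto simp: s_def vars_foldl_Dot)
  then have "even_vars M'"
    using M(1) by (auto simp: even_vars_def M'_def)
  moreover have "T \<turnstile>\<^sub>S\<^sub>E realize_seq (joins (\<lambda>n. L n @ M' n) \<tau>) \<Gamma> \<Delta>" for \<tau>
  proof -
    let ?\<rho> = "joins (\<lambda>n. L n @ M' n) \<tau>"
    have \<rho>: "?\<rho> = joins ?L (joins (\<lambda>m. if m = n then [s] else []) \<tau>)"
      by (simp add: M'_def flip: joins_append)
    have "T \<turnstile>\<^sub>S\<^sub>E foldr (\<rightarrow>\<^sub>j) (map (\<lambda>x. Just (case x of (m, A) \<Rightarrow> Var (2 * m)) (case x of (m, A) \<Rightarrow> realize ?\<rho> False A))
        (unbox \<Gamma>)) (Just s (realize ?\<rho> True B))"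
      unfolding s_def by (rule SE_derives.mp[OF SE_derives_application_list]) (use k_imp \<rho> in metis)
    moreover have "T \<turnstile>\<^sub>S\<^sub>E Just s (realize ?\<rho> True B) \<rightarrow>\<^sub>j Just (?\<rho> n) (realize ?\<rho> True B)"
      by (rule joins_member) (simp add: M'_def)
    ultimately show ?thesis
    proof (rule SE_derives_taut_mp2)
      fix v
      assume 1: "prop_eval v (foldr (\<rightarrow>\<^sub>j) (map (\<lambda>x. Just (case x of (m, A) \<Rightarrow> Var (2 * m))
          (case x of (m, A) \<Rightarrow> realize ?\<rho> False A)) (unbox \<Gamma>)) (Just s (realize ?\<rho> True B)))"
        and 2: "prop_eval v (Just s (realize ?\<rho> True B) \<rightarrow>\<^sub>j Just (?\<rho> n) (realize ?\<rho> True B))"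
      have "prop_eval v (realize ?\<rho> True (ABox n B))"
        if \<Gamma>: "\<forall>A\<in>set \<Gamma>. prop_eval v (realize ?\<rho> False A)"
      proof -
        have "v (Just (Var (2 * m)) (realize ?\<rho> False A))" if "(m, A) \<in> set (unbox \<Gamma>)" for m A
          using \<Gamma> that by (fastforce simp: set_unbox)
        then show ?thesis using 1 2 by auto
      qed
      then show "prop_eval v (realize_seq ?\<rho> \<Gamma> \<Delta>)"
        unfolding prop_eval_realize_seq using box.hyps(1) by blast
    qed
  qed
  ultimately show ?case by blast
qed

end

section \<open>Annotation by paths\<close>

text \<open>Bijective base 3: with digits 1, 2, 3 instead of 0, 1, 2, paths of different lengths
  also get different codes.\<close>

primrec path_code :: "step list \<Rightarrow> nat" where
  "path_code [] = 0"
| "path_code (a # p) = 3 * path_code p + (case a of ImpL \<Rightarrow> 1 | ImpR \<Rightarrow> 2 | Under \<Rightarrow> 3)"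

lemma path_code_inject: "path_code p = path_code q \<Longrightarrow> p = q"
proof (induction p arbitrary: q)
  case Nil
  then show ?case by (cases q) (auto split: step.splits)
next
  case (Cons a p)
  then obtain b q' where q: "q = b # q'" by (cases q) (auto split: step.splits)
  then have "a = b \<and> path_code p = path_code q'"
    using Cons.prems by (cases a; cases b) (simp_all, presburger+)
  then show ?case using Cons.IH q by simp
qed

primrec annotate :: "step list \<Rightarrow> 'p mfm \<Rightarrow> 'p afm" where
  "annotate p MBot = ABot"
| "annotate p (MAtom P) = AAtom P"
| "annotate p (F \<rightarrow>\<^sub>m G) = AImp (annotate (p @ [ImpL]) F) (annotate (p @ [ImpR]) G)"
| "annotate p (Box F) = ABox (path_code p) (annotate (p @ [Under]) F)"

lemma erase_annotate [simp]: "erase (annotate p F) = F"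
  by (induction F arbitrary: p) auto

lemma forget_realize: "forget (realize \<rho> b A) = erase A"
  by (induction A arbitrary: b) auto

text \<open>\<open>occ\<close> extends a path at its end while \<open>term_at\<close> consumes it
  from the front; the arbitrary remainder \<open>q\<close> reconciles the two in the
  induction.\<close>

lemma term_at_realize_annotate:
  "occ F p b G \<Longrightarrow>
    term_at (realize \<rho> True (annotate [] F)) (p @ q) = term_at (realize \<rho> b (annotate p G)) q"
  by (induction arbitrary: q rule: occ.induct) auto

text \<open>Negative boxes ignore \<rho>, so the terms of positive boxes may be chosen separately
  for each formula, from a derivation of it.\<close>

lemma normal_realization_realize_annotate:
  "normal_realization (\<lambda>F. realize (\<rho> F) True (annotate [] F))"
  unfolding normal_realization_def
proof (intro conjI allI exI ballI)
  show "realization (\<lambda>F. realize (\<rho> F) True (annotate [] F))"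
    by (simp add: realization_def forget_realize)
next
  fix F :: "'a mfm"
  show "inj_on (\<lambda>p. 2 * path_code p) (negative_boxes F)"
    by (auto intro!: inj_onI path_code_inject)
next
  fix F :: "'a mfm" and p
  assume "p \<in> negative_boxes F"
  then obtain G where "occ F p False (Box G)" by (auto simp: negative_boxes_def)
  from term_at_realize_annotate[OF this, of "\<rho> F" "[]"]
  show "term_at (realize (\<rho> F) True (annotate [] F)) p = Some (Var (2 * path_code p))"
    by simp
qed

theorem mainTheorem4:
  fixes T :: "'p fm set" and c :: jconst and x y :: nat
  assumes "axiomatically_appropriate T"
    and "schematic T"
    and "x \<noteq> y"
    and "\<And>A B. Just (Var x) A \<rightarrow>\<^sub>j Just (Const c \<odot> Var x \<odot> Var y) (A \<or>\<^sub>j B) \<in> T"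
    and "\<And>A B. Just (Var y) B \<rightarrow>\<^sub>j Just (Const c \<odot> Var x \<odot> Var y) (A \<or>\<^sub>j B) \<in> T"
  shows "\<exists>r :: 'p mfm \<Rightarrow> 'p fm. normal_realization r \<and> (\<forall>F. (\<turnstile>\<^sub>K F) \<longrightarrow> (T \<turnstile>\<^sub>S\<^sub>E r F))"
proof -
  obtain d where d: "\<And>A. tautology A \<Longrightarrow> Just (Const d) A \<in> T"
    using schematic_CL_constant[OF assms(1,2)] by blast
  have join: "T \<turnstile>\<^sub>S\<^sub>E Just s A \<rightarrow>\<^sub>j Just (join d c s t) A \<and> T \<turnstile>\<^sub>S\<^sub>E Just t A \<rightarrow>\<^sub>j Just (join d c s t) A" for s t A
  proof -
    \<comment> \<open>\<open>A\<close> may contain \<open>x\<close> and \<open>y\<close>. The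
      hypotheses are used for a copy of \<open>A\<close> with all variables shifted beyond both;
      \<tau> undoes the shift while inserting \<open>s\<close> and \<open>t\<close>.\<close>
    define \<sigma> where "\<sigma> i = Var (i + x + y + 1)" for i
    define \<tau> where "\<tau> = (\<lambda>i. Var (i - (x + y + 1)))(x := s, y := t)"
    have \<tau>: "ssubst \<tau> (ssubst \<sigma> A) = A" "\<tau> x = s" "\<tau> y = t"
      using assms(3) by (simp_all add: ssubst_ssubst \<sigma>_def \<tau>_def)
    have "T \<turnstile>\<^sub>S\<^sub>E Just s A \<rightarrow>\<^sub>j Just (Const c \<odot> s \<odot> t) (A \<or>\<^sub>j A)"
      using SE_derives_ssubst[OF SE_derives.mem[OF assms(4)[of "ssubst \<sigma> A" "ssubst \<sigma> A"]], of \<tau>] \<tau>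
      by simp
    moreover have "T \<turnstile>\<^sub>S\<^sub>E Just t A \<rightarrow>\<^sub>j Just (Const c \<odot> s \<odot> t) (A \<or>\<^sub>j A)"
      using SE_derives_ssubst[OF SE_derives.mem[OF assms(5)[of "ssubst \<sigma> A" "ssubst \<sigma> A"]], of \<tau>] \<tau>
      by simp
    moreover have "T \<turnstile>\<^sub>S\<^sub>E Just (Const c \<odot> s \<odot> t) (A \<or>\<^sub>j A) \<rightarrow>\<^sub>j Just (join d c s t) A"
      unfolding join_def
      by (rule SE_derives.mp[OF SE_derives_application SE_derives.mem[OF d]]) (simp add: tautology_def)
    ultimately show ?thesis
      by (auto elim: SE_derives_taut_mp2)
  qed
  interpret realizing_theory T c d
    by unfold_locales (use assms(1) join in auto)
  have "\<exists>\<rho>. T \<turnstile>\<^sub>S\<^sub>E realize \<rho> True (annotate [] F)" if "\<turnstile>\<^sub>K F" for F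
  proof -
    have "seq [] [annotate [] F]"
      using seq_complete[of "[]" "[annotate [] F]"] K_sound[OF that] by (auto simp: refutes_def)
    then obtain M where M: "\<And>\<tau>. T \<turnstile>\<^sub>S\<^sub>E realize_seq (joins (\<lambda>n. [] @ M n) \<tau>) [] [annotate [] F]"
      using seq_realizable[of "[]" "[annotate [] F]" "\<lambda>_. []"] unfolding even_vars_def by auto
    show ?thesis
      \<comment> \<open>Any tail would do here; \<open>Var\<close> is an arbitrary choice.\<close>
      by (rule exI, rule SE_derives_taut_mp[OF M[of Var]]) simp
  qed
  then obtain \<rho> where "\<And>F. \<turnstile>\<^sub>K F \<Longrightarrow> T \<turnstile>\<^sub>S\<^sub>E realize (\<rho> F) True (annotate [] F)"
    by metis
  then show ?thesis
    using normal_realization_realize_annotate[of \<rho>] by blast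
qed

end
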